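(* Let $N\ge 3$ be an integer, let $\kappa\in\mathbb{R}$, and let $p(z)=1+\kappa(z+z^{N-1})+z^N$. Then all (complex) zeros of $p$ lie on the unit circle $\{z\in\mathbb{C}:|z|=1\}$ if and only if \[ -1\le\kappa\le \begin{cases} 1 & \text{if } N \text{ is even},\\ \dfrac{N}{N-2} & \text{if } N \text{ is odd}. \end{cases} \] *)

theory Defs
  imports Complex_Main
begin

end

theory Submission
  imports Defs
begin

text \<open>
  By self-reciprocity it suffices to exclude zeros in the open unit disc. For \<open>\<bar>\<kappa>\<bar> \<le> 1\<close> this follows
  from \<open>z ^ (N - 1) * (z + \<kappa>) = - (1 + \<kappa> * z)\<close> and
  \<open>\<bar>1 + \<kappa> * z\<bar>\<^sup>2 - \<bar>z + \<kappa>\<bar>\<^sup>2 = (1 - \<kappa>\<^sup>2) * (1 - \<bar>z\<bar>\<^sup>2) \<ge> 0\<close>.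
  For odd \<open>N\<close> and \<open>\<kappa> > 1\<close> put \<open>w = - z\<close> and \<open>n = N - 1\<close>; cancelling the factor \<open>1 - w\<close> turns
  \<open>p z = 0\<close> into \<open>1 + w ^ n = (\<kappa> - 1) * (w + \<dots> + w ^ (n - 1))\<close>, that is,
  \<open>(\<Sum>k=1..<n. (1 - w ^ k) * (1 - w ^ (n - k))) = (n - 1 - 2 / (\<kappa> - 1)) * (1 + w ^ n)\<close>.
  After division by \<open>1 - w ^ n\<close> the left side has positive real part on the disc, while for
  \<open>\<kappa> \<le> N / (N - 2)\<close> the right side has nonpositive real part. Outside the stated range of \<open>\<kappa>\<close> the
  intermediate value theorem gives a real zero in \<open>(-1, 1)\<close>.
\<close>

text \<open>The real part is (1 - Re a) / |1 - a|^2, and 2 * (1 - Re a) > |1 - a|^2 rearranges to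
  |a| < 1.\<close>

lemma Re_inverse_one_minus_gt_half:
  assumes "cmod a < 1"
  shows "Re (inverse (1 - a)) > 1 / 2"
proof -
  have "(Re a)\<^sup>2 + (Im a)\<^sup>2 < 1"
    using assms by (simp add: cmod_def)
  moreover from this have "Re a < 1"
    by (smt (verit) one_power2 power_mono zero_le_power2)
  hence "(1 - Re a)\<^sup>2 + (Im a)\<^sup>2 > 0"
    by (intro add_pos_nonneg) auto
  ultimately have "1 / 2 < (1 - Re a) / ((1 - Re a)\<^sup>2 + (Im a)\<^sup>2)"
    by (simp add: pos_less_divide_eq power2_diff)
  thus ?thesis by simp
qed

lemma Re_cayley_pos:
  assumes "cmod a < 1"
  shows "Re ((1 + a) / (1 - a)) > 0"
proof -
  have "a \<noteq> 1" using assms by auto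
  hence "(1 + a) / (1 - a) = inverse (1 - a) + inverse (1 - a) - 1"
    by (simp add: field_simps)
  hence "Re ((1 + a) / (1 - a)) = Re (inverse (1 - a)) + Re (inverse (1 - a)) - 1"
    by (simp only: minus_complex.sel plus_complex.sel one_complex.sel)
  thus ?thesis using Re_inverse_one_minus_gt_half[OF assms] by linarith
qed

lemma Re_pos_of_Re_inverse_pos:
  assumes "Re (inverse z) > 0"
  shows "Re z > 0"
  using assms by (auto simp: zero_less_divide_iff not_sum_power2_lt_zero)

text \<open>The reciprocal splits into 1/(1 - a) + 1/(1 - b) - 1, where each fraction has real part
  above 1/2; inversion preserves the sign of the real part.\<close>

lemma Re_product_quotient_pos:
  assumes "cmod a < 1" "cmod b < 1"
  shows "Re ((1 - a) * (1 - b) / (1 - a * b)) > 0"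
proof (rule Re_pos_of_Re_inverse_pos)
  have "a \<noteq> 1" "b \<noteq> 1" using assms by auto
  hence "inverse ((1 - a) * (1 - b) / (1 - a * b)) = inverse (1 - a) + inverse (1 - b) - 1"
    by (simp add: divide_simps) (simp add: algebra_simps)
  hence "Re (inverse ((1 - a) * (1 - b) / (1 - a * b)))
      = Re (inverse (1 - a)) + Re (inverse (1 - b)) - 1"
    by (simp only: minus_complex.sel plus_complex.sel one_complex.sel)
  thus "Re (inverse ((1 - a) * (1 - b) / (1 - a * b))) > 0"
    using assms[THEN Re_inverse_one_minus_gt_half] by linarith
qed

lemma one_plus_power_neq_mult_sum:
  fixes w :: complex and \<mu> :: real
  assumes "cmod w < 1" and "n \<ge> 2" and "\<mu> > 0" and "\<mu> * (real n - 1) \<le> 2"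
  shows "1 + w ^ n \<noteq> of_real \<mu> * (\<Sum>k=1..<n. w ^ k)"
proof
  assume eq: "1 + w ^ n = of_real \<mu> * (\<Sum>k=1..<n. w ^ k)"
  \<comment> \<open>This is the coefficient left on \<open>1 + w ^ n\<close> once the power sum is
    eliminated by \<open>eq\<close>; the bound on \<mu> says exactly that it is nonpositive.\<close>
  define c where "c = real n - 1 - 2 / \<mu>"
  have less1: "cmod (w ^ k) < 1" if "k \<ge> 1" for k
    using assms(1) that by (simp add: norm_power power_less_one_iff)
  have sum_rev: "(\<Sum>k=1..<n. w ^ (n - k)) = (\<Sum>k=1..<n. w ^ k)"
    by (rule sum.reindex_bij_witness[of _ "\<lambda>k. n - k" "\<lambda>k. n - k"]) auto
  have "(\<Sum>k=1..<n. (1 - w ^ k) * (1 - w ^ (n - k)))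
      = (\<Sum>k=1..<n. (1 + w ^ n) - w ^ k - w ^ (n - k))"
    by (intro sum.cong refl) (simp add: algebra_simps flip: power_add)
  also have "\<dots> = of_nat (n - 1) * (1 + w ^ n) - 2 * (\<Sum>k=1..<n. w ^ k)"
    by (simp only: sum_subtractf sum_rev sum_constant card_atLeastLessThan) (simp add: algebra_simps)
  also have "(\<Sum>k=1..<n. w ^ k) = (1 + w ^ n) / of_real \<mu>"
    using eq assms(3) by simp
  also have "of_nat (n - 1) * (1 + w ^ n) - 2 * ((1 + w ^ n) / of_real \<mu>) = of_real c * (1 + w ^ n)"
    using assms(2) by (simp add: c_def of_nat_diff algebra_simps)
  finally have "(\<Sum>k=1..<n. (1 - w ^ k) * (1 - w ^ (n - k)) / (1 - w ^ n))
      = of_real c * ((1 + w ^ n) / (1 - w ^ n))"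
    by (simp flip: sum_divide_distrib)
  hence "(\<Sum>k=1..<n. Re ((1 - w ^ k) * (1 - w ^ (n - k)) / (1 - w ^ n)))
      = c * Re ((1 + w ^ n) / (1 - w ^ n))"
    by (simp only: Re_sum[symmetric] times_complex.sel Re_complex_of_real Im_complex_of_real
        mult_zero_left diff_zero)
  moreover have "(\<Sum>k=1..<n. Re ((1 - w ^ k) * (1 - w ^ (n - k)) / (1 - w ^ n))) > 0"
  proof (rule sum_pos)
    fix k assume "k \<in> {1..<n}"
    \<comment> \<open>Both exponents are positive and add up to \<open>n\<close>, so
      \<open>w ^ n\<close> is the product of two points of the disc.\<close>
    hence "1 \<le> k" "1 \<le> n - k" "k + (n - k) = n" by auto
    thus "Re ((1 - w ^ k) * (1 - w ^ (n - k)) / (1 - w ^ n)) > 0"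
      using Re_product_quotient_pos[OF less1 less1, of k "n - k"] by (simp only: power_add[symmetric])
  qed (use assms(2) in auto)
  moreover have "c \<le> 0"
    using assms(3,4) by (simp add: c_def field_simps)
  moreover have "Re ((1 + w ^ n) / (1 - w ^ n)) > 0"
    using assms(2) by (intro Re_cayley_pos less1) simp
  ultimately show False
    by (smt (verit) mult_nonpos_nonneg)
qed

lemma no_zero_in_disc_odd:
  fixes z :: complex and \<kappa> :: real
  assumes "N \<ge> 3" and "odd N" and "1 < \<kappa>" and "\<kappa> \<le> real N / (real N - 2)" and "cmod z < 1"
  shows "1 + of_real \<kappa> * (z + z ^ (N - 1)) + z ^ N \<noteq> 0"
proof
  assume zero: "1 + of_real \<kappa> * (z + z ^ (N - 1)) + z ^ N = 0"
  define w where "w = - z"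
  obtain n where n: "N = Suc n" "n \<ge> 2" "even n"
    using assms(1,2) by (cases N) auto
  have w: "cmod w < 1" "w \<noteq> 1" using assms(5) by (auto simp: w_def dest: arg_cong[of _ _ cmod])
  have z: "z = - w" by (simp add: w_def)
  \<comment> \<open>For odd N, -1 is always a zero of p; it appears here as the factor
    \<open>1 - w\<close>. Evenness of \<open>n\<close> fixes the signs.\<close>
  have "(1 - w) * (1 + w ^ n) = of_real (\<kappa> - 1) * (w - w ^ n)"
    using zero n by (simp add: z algebra_simps)
  also have "w - w ^ n = (1 - w) * (\<Sum>k=1..<n. w ^ k)"
    using sum_gp_multiplied[of 1 "n - 1" w] n
    by (simp add: atLeastLessThanSuc_atLeastAtMost[symmetric] del: sum.op_ivl_Suc)
  finally have "1 + w ^ n = of_real (\<kappa> - 1) * (\<Sum>k=1..<n. w ^ k)"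
    using w(2) by simp
  moreover have "(\<kappa> - 1) * (real n - 1) \<le> 2"
    using assms(4) n by (simp add: field_simps)
  ultimately show False
    using one_plus_power_neq_mult_sum[of w n "\<kappa> - 1"] w n assms(3) by simp
qed

lemma no_zero_in_disc_small:
  fixes z :: complex and \<kappa> :: real
  assumes "N \<ge> 2" and "\<bar>\<kappa>\<bar> \<le> 1" and "cmod z < 1"
  shows "1 + of_real \<kappa> * (z + z ^ (N - 1)) + z ^ N \<noteq> 0"
proof
  assume zero: "1 + of_real \<kappa> * (z + z ^ (N - 1)) + z ^ N = 0"
  obtain n where n: "N = Suc n" "n \<ge> 1"
    using assms(1) by (cases N) auto
  have "(cmod (1 + of_real \<kappa> * z))\<^sup>2 - (cmod (z + of_real \<kappa>))\<^sup>2 = (1 - \<kappa>\<^sup>2) * (1 - (cmod z)\<^sup>2)"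
    by (simp add: cmod_power2) (simp add: power2_eq_square algebra_simps)
  moreover have "\<dots> \<ge> 0"
    using assms(2,3) by (intro mult_nonneg_nonneg) (auto simp: abs_square_le_1 power_le_one)
  ultimately have "(cmod (z + of_real \<kappa>))\<^sup>2 \<le> (cmod (1 + of_real \<kappa> * z))\<^sup>2"
    by linarith
  hence le: "cmod (z + of_real \<kappa>) \<le> cmod (1 + of_real \<kappa> * z)"
    by (rule power2_le_imp_le) simp
  have "z ^ n * (z + of_real \<kappa>) = - (1 + of_real \<kappa> * z)"
    using zero n by (simp add: eq_neg_iff_add_eq_0 algebra_simps)
  hence eq: "cmod z ^ n * cmod (z + of_real \<kappa>) = cmod (1 + of_real \<kappa> * z)"
    by (metis norm_minus_cancel norm_mult norm_power)
  \<comment> \<open>The comparison \<open>le\<close> need not be strict (\<kappa> = 1 or -1), so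
    strictness comes from this factor; it forces 1 + \<kappa> z = 0, which |\<kappa> z| < 1
    excludes.\<close>
  have "cmod z ^ n < 1"
    using assms(3) n by (simp add: power_less_one_iff)
  moreover have "cmod (1 + of_real \<kappa> * z) \<le> cmod z ^ n * cmod (1 + of_real \<kappa> * z)"
    using mult_left_mono[OF le, of "cmod z ^ n"] eq by simp
  ultimately have "cmod (1 + of_real \<kappa> * z) = 0"
    by (smt (verit) mult_le_cancel_right1 norm_ge_zero)
  hence "cmod (of_real \<kappa> * z) = 1"
    by (metis add.commute add_eq_0_iff norm_eq_zero norm_minus_cancel norm_one)
  moreover have "\<bar>\<kappa>\<bar> * cmod z \<le> 1 * cmod z"
    using assms(2) by (intro mult_right_mono) auto
  ultimately show False
    using assms(3) by (simp add: norm_mult)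
qed

text \<open>Multiplication by \<open>z ^ N\<close> reverses the coefficient sequence, which is
  palindromic.\<close>

lemma zero_inverse_iff:
  fixes z c :: "'a :: field"
  assumes "N \<ge> 1" and "z \<noteq> 0"
  shows "1 + c * (inverse z + inverse z ^ (N - 1)) + inverse z ^ N = 0
     \<longleftrightarrow> 1 + c * (z + z ^ (N - 1)) + z ^ N = 0"
proof -
  obtain n where n: "N = Suc n" using assms(1) by (cases N) auto
  have "z ^ N * (1 + c * (inverse z + inverse z ^ (N - 1)) + inverse z ^ N)
      = 1 + c * (z + z ^ (N - 1)) + z ^ N"
    using assms(2) by (simp add: n field_simps)
  thus ?thesis using assms(2) by (metis mult_eq_0_iff power_not_zero)
qed

text \<open>The order of a and b is left open because the negative value is later found on either
  side of 0.\<close>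

lemma real_zero_between:
  fixes f :: "real \<Rightarrow> real"
  assumes "f a < 0" and "f b > 0" and "\<And>x. isCont f x"
  obtains x where "min a b < x" "x < max a b" "f x = 0"
proof (cases "a \<le> b")
  case True
  then obtain x where "a \<le> x" "x \<le> b" "f x = 0"
    using IVT[of f a 0 b] assms by auto
  moreover from this have "x \<noteq> a" "x \<noteq> b" using assms by auto
  ultimately show ?thesis using that[of x] True by auto
next
  case False
  then obtain x where "b \<le> x" "x \<le> a" "f x = 0"
    using IVT2[of f a 0 b] assms by auto
  moreover from this have "x \<noteq> a" "x \<noteq> b" using assms by auto
  ultimately show ?thesis using that[of x] False by auto
qed

lemma exists_real_zero_in_disc:
  fixes \<kappa> :: real
  assumes "N \<ge> 3" and "\<kappa> < - 1 \<or> \<kappa> > (if even N then 1 else real N / (real N - 2))"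
  obtains x where "\<bar>x\<bar> < 1" "1 + \<kappa> * (x + x ^ (N - 1)) + x ^ N = 0"
proof -
  define f where "f x = 1 + \<kappa> * (x + x ^ (N - 1)) + x ^ N" for x :: real
  have cont: "isCont f x" for x unfolding f_def by (intro continuous_intros)
  have f0: "f 0 > 0" using assms(1) by (simp add: f_def power_0_left)
  have "\<exists>a. \<bar>a\<bar> \<le> 1 \<and> f a < 0"
  proof (cases "\<kappa> < - 1 \<or> even N")
    case True
    show ?thesis
    proof (cases "\<kappa> < - 1")
      case True
      thus ?thesis by (intro exI[of _ 1]) (simp add: f_def)
    next
      case False
      with True assms have "even N" "\<kappa> > 1" by auto
      thus ?thesis using assms(1) by (intro exI[of _ "- 1"]) (simp add: f_def)
    qed
  next
    case False
    hence odd: "odd N" and \<kappa>: "\<kappa> > real N / (real N - 2)" using assms by auto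
    obtain n where n: "N = Suc (Suc n)" "odd n" "n \<ge> 1"
      using assms(1) odd by (cases N; cases "N - 1") auto
    have f_minus1: "f (- 1) = 0" using n by (simp add: f_def)
    \<comment> \<open>For odd N the value at -1 is 0 and gives no sign; a negative slope there makes
      f negative just to the right.\<close>
    have "(f has_real_derivative (real N - \<kappa> * (real N - 2))) (at (- 1))"
      unfolding f_def using n
      by (auto intro!: derivative_eq_intros simp: algebra_simps)
    moreover have "real N - \<kappa> * (real N - 2) < 0"
      using \<kappa> n by (simp add: field_simps)
    ultimately obtain d where d: "d > 0" "\<And>h. 0 < h \<Longrightarrow> h < d \<Longrightarrow> f (- 1 + h) < f (- 1)"
      using DERIV_neg_dec_right by metis
    show ?thesis
      \<comment> \<open>Halving keeps the increment below \<open>d\<close>, and the cap 1 keeps the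
        point in (-1, 0].\<close>
      using d f_minus1 by (intro exI[of _ "- 1 + min (d / 2) 1"]) auto
  qed
  then obtain a where a: "\<bar>a\<bar> \<le> 1" "f a < 0" by blast
  obtain x where "min a 0 < x" "x < max a 0" "f x = 0"
    using real_zero_between[OF a(2) f0 cont] by blast
  with a(1) that[of x] show ?thesis by (auto simp: f_def)
qed

theorem theorem4:
  fixes N :: nat and \<kappa> :: real and p :: "complex \<Rightarrow> complex"
  assumes "N \<ge> 3"
    and "p = (\<lambda>z. 1 + complex_of_real \<kappa> * (z + z ^ (N - 1)) + z ^ N)"
  shows "(\<forall>z. p z = 0 \<longrightarrow> cmod z = 1) \<longleftrightarrow>
         - 1 \<le> \<kappa> \<and> \<kappa> \<le> (if even N then 1 else real N / (real N - 2))"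
proof
  assume zeros: "\<forall>z. p z = 0 \<longrightarrow> cmod z = 1"
  show "- 1 \<le> \<kappa> \<and> \<kappa> \<le> (if even N then 1 else real N / (real N - 2))"
  proof (rule ccontr)
    assume "\<not> ?thesis"
    hence "\<kappa> < - 1 \<or> \<kappa> > (if even N then 1 else real N / (real N - 2))"
      by linarith
    then obtain x where x: "\<bar>x\<bar> < 1" "1 + \<kappa> * (x + x ^ (N - 1)) + x ^ N = 0"
      using exists_real_zero_in_disc assms(1) by blast
    have "p (of_real x) = of_real (1 + \<kappa> * (x + x ^ (N - 1)) + x ^ N)"
      by (simp add: assms(2))
    with zeros x show False by (metis norm_of_real of_real_0 less_irrefl)
  qed
next
  assume \<kappa>: "- 1 \<le> \<kappa> \<and> \<kappa> \<le> (if even N then 1 else real N / (real N - 2))"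
  have disc: "p z \<noteq> 0" if "cmod z < 1" for z
  proof (cases "\<kappa> \<le> 1")
    case True
    with \<kappa> have "\<bar>\<kappa>\<bar> \<le> 1" by linarith
    with that assms no_zero_in_disc_small[of N \<kappa> z] show ?thesis by simp
  next
    \<comment> \<open>For even N this contradicts the upper bound, so only odd N remains.\<close>
    case False
    with \<kappa> that assms no_zero_in_disc_odd[of N \<kappa> z] show ?thesis by (simp split: if_splits)
  qed
  show "\<forall>z. p z = 0 \<longrightarrow> cmod z = 1"
  proof (intro allI impI)
    fix z assume pz: "p z = 0"
    have "z \<noteq> 0" using pz disc[of 0] by auto
    hence "p (inverse z) = 0"
      using pz assms zero_inverse_iff[of N z "of_real \<kappa>"] by simp
    hence "\<not> cmod (inverse z) < 1" using disc by blast
    moreover have "\<not> cmod z < 1" using pz disc by blast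
    ultimately show "cmod z = 1"
      using \<open>z \<noteq> 0\<close> by (simp add: norm_inverse inverse_less_1_iff not_less)
  qed
qed

end
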